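(* Let $A$ be a real $m\times n$ matrix with $m<n$ whose columns have unit $\ell_2$-norm and are not scalar multiples of each other (no column is a scalar multiple of another column). Let $x\in\mathbb{R}^n$ be any vector with at least $m+1$ nonzero entries, and let $X_0=\mathrm{diag}(x)$, possibly with all identically zero columns removed. Then $X_0$ can be recovered from $B=AX_0$ using $\ell_{1,1}$, i.e. $X_0$ is the unique solution of $$\min_X\ \|X\|_{1,1}\quad\text{subject to}\quad AX=B,$$ but $X_0$ cannot be recovered using $\ell_{1,2}$: $X_0$ is not a solution of $$\min_X\ \|X\|_{1,2}\quad\text{subject to}\quad AX=B.$$
   Context: For $X\in\mathbb{R}^{n\times r}$ with rows $X^{j\rightarrow}\in\mathbb{R}^r$, $j=1,\dots,n$, define $\|X\|_{1,q}=\sum_{j=1}^n\|X^{j\rightarrow}\|_q$ for $q=1,2$. In both problems $X$ ranges over real matrices of the same size as $X_0$. *)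

theory Defs
  imports Complex_Main "Jordan_Normal_Form.Matrix"
begin

definition vec_lnorm :: "nat \<Rightarrow> real vec \<Rightarrow> real" where
  "vec_lnorm q v = root q (\<Sum>i<dim_vec v. \<bar>v $ i\<bar> ^ q)"

definition row_norm :: "nat \<Rightarrow> real mat \<Rightarrow> real" where
  "row_norm q X = (\<Sum>j<dim_row X. vec_lnorm q (row X j))"

definition remove_zero_cols :: "real mat \<Rightarrow> real mat" where
  "remove_zero_cols X =
     mat_of_cols (dim_row X) (filter (\<lambda>c. c \<noteq> 0\<^sub>v (dim_row X)) (cols X))"

text \<open>\<open>X\<close> minimizes \<open>row_norm q\<close> among the matrices with \<open>r\<close> columns that solve \<open>A * X = B\<close>.
  The carrier condition is needed because the multiplication of this library is total and
  does not determine the number of rows of \<open>X\<close>.\<close>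

definition row_norm_solution :: "nat \<Rightarrow> real mat \<Rightarrow> real mat \<Rightarrow> nat \<Rightarrow> real mat \<Rightarrow> bool" where
  "row_norm_solution q A B r X \<longleftrightarrow>
     is_arg_min (row_norm q) (\<lambda>Z. Z \<in> carrier_mat (dim_col A) r \<and> A * Z = B) X"

end

(* For l_{1,1} the problem splits into columns, each of the form A z = c a_p.  Pairing this with the
   unit vector a_p gives |c| <= |z_p| + sum_{j ~= p} |<a_p, a_j>| |z_j|, and the inner products are
   strictly below 1 in modulus because no two columns are parallel; so z = c e_p is the unique
   minimizer.  For l_{1,2}, more than m nonzero entries of x yield a kernel vector v of A supported
   on the support of x.  Moving X_0 along the rank-one direction v w^T, where w carries the values
   -sgn(x_j) v_j, changes the norm to first order by -sum_j v_j^2 < 0. *)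

theory Submission
  imports Defs
begin

section \<open>Linear algebra and scalar inequalities\<close>

text \<open>Gaussian elimination, one equation per induction step: an equation that vanishes on
  \<open>S\<close> is dropped, and any other one serves to eliminate one unknown.\<close>

lemma homogeneous_system_nontrivial_solution:
  fixes a :: "nat \<Rightarrow> 'b \<Rightarrow> 'a::field"
  assumes "finite S" "m < card S"
  shows "\<exists>v. (\<exists>j\<in>S. v j \<noteq> 0) \<and> (\<forall>i<m. (\<Sum>j\<in>S. a i j * v j) = 0)"
  using assms
proof (induction m arbitrary: S a)
  case 0
  then have "S \<noteq> {}" by auto
  then show ?case by (intro exI[of _ "\<lambda>_. 1"]) auto
next
  case (Suc m)
  show ?case
  proof (cases "\<forall>j\<in>S. a m j = 0")
    case True
    from Suc.prems have "m < card S" by simp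
    from Suc.IH[OF Suc.prems(1) this, of a] obtain v
      where v: "\<exists>j\<in>S. v j \<noteq> 0" "\<forall>i<m. (\<Sum>j\<in>S. a i j * v j) = 0" by blast
    show ?thesis
    proof (intro exI[of _ v] conjI allI impI)
      fix i assume "i < Suc m"
      then show "(\<Sum>j\<in>S. a i j * v j) = 0"
        using v(2) True by (cases "i = m") auto
    qed (use v(1) in blast)
  next
    case False
    then obtain p where p: "p \<in> S" "a m p \<noteq> 0" by blast
    define T where "T = S - {p}"
    have T: "finite T" "m < card T"
      using Suc.prems p(1) by (auto simp: T_def)
    \<comment> \<open>These are the coefficients left after subtracting the multiple of the pivot
      row \<open>m\<close> that clears the unknown \<open>p\<close>.\<close>
    from Suc.IH[OF T, of "\<lambda>i j. a i j - a i p * a m j / a m p"] obtain v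
      where v: "\<exists>j\<in>T. v j \<noteq> 0"
        and eq: "\<forall>i<m. (\<Sum>j\<in>T. (a i j - a i p * a m j / a m p) * v j) = 0" by blast
    \<comment> \<open>Back substitution: the value of the unknown \<open>p\<close> that equation
      \<open>m\<close> forces.\<close>
    define c where "c = - (\<Sum>j\<in>T. a m j * v j) / a m p"
    have split: "(\<Sum>j\<in>S. a i j * (v(p := c)) j) = a i p * c + (\<Sum>j\<in>T. a i j * v j)" for i
    proof -
      have "(\<Sum>j\<in>T. a i j * (v(p := c)) j) = (\<Sum>j\<in>T. a i j * v j)"
        by (rule sum.cong) (auto simp: T_def)
      then show ?thesis
        using Suc.prems(1) p(1) by (simp add: sum.remove[of S p] T_def)
    qed
    show ?thesis
    proof (intro exI[of _ "v(p := c)"] conjI allI impI)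
      show "\<exists>j\<in>S. (v(p := c)) j \<noteq> 0"
        using v by (auto simp: T_def)
      fix i assume "i < Suc m"
      show "(\<Sum>j\<in>S. a i j * (v(p := c)) j) = 0"
      proof (cases "i = m")
        case True
        then show ?thesis unfolding split using p(2) by (simp add: c_def)
      next
        case False
        with \<open>i < Suc m\<close> have "(\<Sum>j\<in>T. (a i j - a i p * a m j / a m p) * v j) = 0"
          using eq by simp
        moreover have "(\<Sum>j\<in>T. (a i j - a i p * a m j / a m p) * v j)
            = (\<Sum>j\<in>T. a i j * v j) + a i p * c"
          by (simp add: c_def left_diff_distrib sum_subtractf sum_distrib_left
              sum_divide_distrib mult.assoc)
        ultimately show ?thesis unfolding split by (simp add: add.commute)
      qed
    qed
  qed
qed

text \<open>Strict Cauchy-Schwarz: the residual of projecting \<open>a\<close> onto \<open>b\<close>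
  has squared length 1 - c^2, where c is the inner product, and it is nonzero because
  \<open>a\<close> is not a multiple of \<open>b\<close>.\<close>

lemma abs_inner_unit_less_one:
  fixes a b :: "'b \<Rightarrow> real"
  assumes fin: "finite I"
    and a: "(\<Sum>i\<in>I. (a i)\<^sup>2) = 1" and b: "(\<Sum>i\<in>I. (b i)\<^sup>2) = 1"
    and not_parallel: "\<not> (\<exists>c. \<forall>i\<in>I. a i = c * b i)"
  shows "\<bar>\<Sum>i\<in>I. a i * b i\<bar> < 1"
proof -
  define c where "c = (\<Sum>i\<in>I. a i * b i)"
  have "(\<Sum>i\<in>I. (a i - c * b i)\<^sup>2)
      = (\<Sum>i\<in>I. (a i)\<^sup>2 - 2 * c * (a i * b i) + c\<^sup>2 * (b i)\<^sup>2)"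
    by (rule sum.cong) (auto simp: power2_eq_square algebra_simps)
  also have "\<dots> = 1 - 2 * c * c + c\<^sup>2"
    by (simp add: sum.distrib sum_subtractf flip: sum_distrib_left)
      (simp add: a b c_def)
  finally have eq: "(\<Sum>i\<in>I. (a i - c * b i)\<^sup>2) = 1 - c\<^sup>2"
    by (simp add: power2_eq_square)
  have "(\<Sum>i\<in>I. (a i - c * b i)\<^sup>2) \<noteq> 0"
    using not_parallel fin by (subst sum_nonneg_eq_0_iff) auto
  moreover have "(\<Sum>i\<in>I. (a i - c * b i)\<^sup>2) \<ge> 0"
    by (rule sum_nonneg) simp
  ultimately have "c\<^sup>2 < 1" using eq by linarith
  then show ?thesis by (simp add: c_def abs_square_less_1)
qed

text \<open>The problem for a single column. The second claim is the equality case of the first and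
  yields uniqueness.\<close>

lemma l1_recovery_one_sparse:
  fixes a :: "'b \<Rightarrow> 'c \<Rightarrow> real"
  assumes fin: "finite J" and p: "p \<in> J"
    and unit: "(\<Sum>i\<in>I. (a i p)\<^sup>2) = 1"
    and incoherent: "\<And>j. j \<in> J \<Longrightarrow> j \<noteq> p \<Longrightarrow> \<bar>\<Sum>i\<in>I. a i p * a i j\<bar> < 1"
    and eq: "\<And>i. i \<in> I \<Longrightarrow> (\<Sum>j\<in>J. a i j * z j) = a i p * c"
  shows "\<bar>c\<bar> \<le> (\<Sum>j\<in>J. \<bar>z j\<bar>)"
    and "(\<Sum>j\<in>J. \<bar>z j\<bar>) \<le> \<bar>c\<bar> \<Longrightarrow> j \<in> J \<Longrightarrow> z j = (if j = p then c else 0)"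
proof -
  define g where "g j = (\<Sum>i\<in>I. a i p * a i j)" for j
  have gp: "g p = 1" using unit by (simp add: g_def power2_eq_square)
  have g_le: "\<bar>g j\<bar> \<le> 1" if "j \<in> J" for j
    using incoherent[OF that] gp by (cases "j = p") (auto simp: g_def)
  \<comment> \<open>The unit norm of column \<open>p\<close> inserts the factor 1, so that the
    system can be substituted for \<open>a i p * c\<close>.\<close>
  have "c = (\<Sum>i\<in>I. a i p * (a i p * c))"
    using unit by (simp add: power2_eq_square flip: mult.assoc sum_distrib_right)
  also have "\<dots> = (\<Sum>i\<in>I. \<Sum>j\<in>J. a i p * a i j * z j)"
    by (rule sum.cong) (auto simp: eq[symmetric] sum_distrib_left mult.assoc)
  also have "\<dots> = (\<Sum>j\<in>J. g j * z j)"
    by (subst sum.swap) (simp add: g_def sum_distrib_right)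
  finally have c: "c = (\<Sum>j\<in>J. g j * z j)" .
  have le: "\<bar>g j * z j\<bar> \<le> \<bar>z j\<bar>" if "j \<in> J" for j
    using mult_right_mono[OF g_le[OF that], of "\<bar>z j\<bar>"] by (simp add: abs_mult)
  have upper: "\<bar>c\<bar> \<le> (\<Sum>j\<in>J. \<bar>g j * z j\<bar>)"
    unfolding c by (rule sum_abs)
  also have "\<dots> \<le> (\<Sum>j\<in>J. \<bar>z j\<bar>)"
    by (rule sum_mono) (rule le)
  finally show "\<bar>c\<bar> \<le> (\<Sum>j\<in>J. \<bar>z j\<bar>)" .
  assume min: "(\<Sum>j\<in>J. \<bar>z j\<bar>) \<le> \<bar>c\<bar>" and j: "j \<in> J"
  \<comment> \<open>A nonzero entry off \<open>p\<close> carries a weight \<open>g k\<close> of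
    modulus below 1; the bound in \<open>upper\<close> would then lie strictly below the l_1 norm,
    against \<open>min\<close>.\<close>
  have off: "z k = 0" if k: "k \<in> J" "k \<noteq> p" for k
  proof (rule ccontr)
    assume "z k \<noteq> 0"
    then have "\<bar>g k * z k\<bar> < \<bar>z k\<bar>"
      using incoherent[OF k] by (simp add: g_def abs_mult)
    then have "(\<Sum>j\<in>J. \<bar>g j * z j\<bar>) < (\<Sum>j\<in>J. \<bar>z j\<bar>)"
      using k le by (intro sum_strict_mono_ex1[OF fin]) auto
    with upper min show False by linarith
  qed
  have "c = g p * z p + (\<Sum>j\<in>J - {p}. g j * z j)"
    unfolding c by (rule sum.remove[OF fin p])
  also have "(\<Sum>j\<in>J - {p}. g j * z j) = 0"
    by (rule sum.neutral) (use off in auto)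
  finally show "z j = (if j = p then c else 0)"
    using gp off j by auto
qed

text \<open>The right side is the tangent of the concave square root at \<open>a\<^sup>2\<close>;
  its square exceeds the radicand by a square.\<close>

lemma sqrt_square_add_le:
  fixes a s :: real
  assumes "a \<noteq> 0" "0 \<le> a\<^sup>2 + s"
  shows "sqrt (a\<^sup>2 + s) \<le> \<bar>a\<bar> + s / (2 * \<bar>a\<bar>)"
proof (rule real_le_lsqrt)
  have *: "\<bar>a\<bar> + s / (2 * \<bar>a\<bar>) = (a\<^sup>2 + (a\<^sup>2 + s)) / (2 * \<bar>a\<bar>)"
    using assms(1) by (simp add: field_simps power2_eq_square)
  show "0 \<le> \<bar>a\<bar> + s / (2 * \<bar>a\<bar>)"
    unfolding * using add_nonneg_nonneg[OF zero_le_power2 assms(2)]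
    by (rule divide_nonneg_nonneg) simp
  have "(\<bar>a\<bar> + s / (2 * \<bar>a\<bar>))\<^sup>2 = a\<^sup>2 + s + (s / (2 * \<bar>a\<bar>))\<^sup>2"
    using assms(1) by (simp add: power2_sum)
  then show "a\<^sup>2 + s \<le> (\<bar>a\<bar> + s / (2 * \<bar>a\<bar>))\<^sup>2" by simp
qed

section \<open>Entrywise forms of the norms and of the constraint\<close>

text \<open>With the column sum outermost, the l_{1,1} problem decouples over the columns.\<close>

lemma row_norm_1_eq:
  assumes "X \<in> carrier_mat n r"
  shows "row_norm 1 X = (\<Sum>k<r. \<Sum>j<n. \<bar>X $$ (j, k)\<bar>)"
  using assms by (subst sum.swap) (simp add: row_norm_def vec_lnorm_def)

lemma row_norm_2_eq:
  assumes "X \<in> carrier_mat n r"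
  shows "row_norm 2 X = (\<Sum>j<n. sqrt (\<Sum>k<r. (X $$ (j, k))\<^sup>2))"
  using assms by (simp add: row_norm_def vec_lnorm_def sqrt_def)

lemma mat_mult_eq_iff:
  assumes "A \<in> carrier_mat m n" "X \<in> carrier_mat n r" "Y \<in> carrier_mat n r"
  shows "A * X = A * Y \<longleftrightarrow> (\<forall>i<m. \<forall>k<r.
    (\<Sum>j<n. A $$ (i, j) * X $$ (j, k)) = (\<Sum>j<n. A $$ (i, j) * Y $$ (j, k)))"
  using assms by (auto simp: mat_eq_iff scalar_prod_def atLeast0LessThan)

text \<open>A common form of \<open>diag x\<close> with and without its zero columns: the column \<open>k\<close> is
  \<open>x $ \<sigma> k\<close> times the unit vector \<open>\<sigma> k\<close>.\<close>

locale diagonal_columns =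
  fixes n r :: nat and x :: "real vec" and \<sigma> :: "nat \<Rightarrow> nat" and X\<^sub>0 :: "real mat"
  assumes X0: "X\<^sub>0 \<in> carrier_mat n r"
    and inj: "inj_on \<sigma> {..<r}"
    and range: "\<And>k. k < r \<Longrightarrow> \<sigma> k < n"
    and support: "\<And>j. j < n \<Longrightarrow> x $ j \<noteq> 0 \<Longrightarrow> j \<in> \<sigma> ` {..<r}"
    and entry: "\<And>j k. j < n \<Longrightarrow> k < r \<Longrightarrow> X\<^sub>0 $$ (j, k) = (if j = \<sigma> k then x $ j else 0)"
begin

section \<open>The two minimization problems for diagonal columns\<close>

lemma l11_unique_solution:
  assumes A: "A \<in> carrier_mat m n"
    and unit: "\<And>j. j < n \<Longrightarrow> (\<Sum>i<m. (A $$ (i, j))\<^sup>2) = 1"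
    and incoherent: "\<And>i j. i < n \<Longrightarrow> j < n \<Longrightarrow> i \<noteq> j \<Longrightarrow>
      \<bar>\<Sum>l<m. A $$ (l, i) * A $$ (l, j)\<bar> < 1"
  shows "row_norm_solution 1 A (A * X\<^sub>0) r X \<longleftrightarrow> X = X\<^sub>0"
proof -
  \<comment> \<open>A general \<open>f\<close> serves both the norm (absolute value) and the
    constraint (multiplication by an entry of \<open>A\<close>).\<close>
  have col_X0: "(\<Sum>j<n. f j (X\<^sub>0 $$ (j, k))) = f (\<sigma> k) (x $ \<sigma> k)"
    if "k < r" and f: "\<And>j. f j 0 = 0" for k and f :: "nat \<Rightarrow> real \<Rightarrow> real"
  proof -
    have "(\<Sum>j<n. f j (X\<^sub>0 $$ (j, k))) = (\<Sum>j<n. if j = \<sigma> k then f j (x $ j) else 0)"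
      using that by (intro sum.cong) (auto simp: entry)
    then show ?thesis using range[OF \<open>k < r\<close>] by simp
  qed
  have norm_X0: "row_norm 1 X\<^sub>0 = (\<Sum>k<r. \<bar>x $ \<sigma> k\<bar>)"
    unfolding row_norm_1_eq[OF X0] by (rule sum.cong) (auto simp: col_X0[of _ "\<lambda>_. abs"])
  have column: "\<bar>x $ \<sigma> k\<bar> \<le> (\<Sum>j<n. \<bar>Z $$ (j, k)\<bar>)"
      "(\<Sum>j<n. \<bar>Z $$ (j, k)\<bar>) \<le> \<bar>x $ \<sigma> k\<bar> \<Longrightarrow> j < n \<Longrightarrow> Z $$ (j, k) = X\<^sub>0 $$ (j, k)"
    if Z: "Z \<in> carrier_mat n r" "A * Z = A * X\<^sub>0" and k: "k < r" for Z j k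
  proof -
    have eq: "(\<Sum>j<n. A $$ (i, j) * Z $$ (j, k)) = A $$ (i, \<sigma> k) * x $ \<sigma> k" if "i < m" for i
      using Z(2) that k col_X0[of k "\<lambda>j. (*) (A $$ (i, j))"]
      unfolding mat_mult_eq_iff[OF A Z(1) X0] by simp
    note recovery = l1_recovery_one_sparse[of "{..<n}" "\<sigma> k" "\<lambda>i j. A $$ (i, j)" "{..<m}"
        "\<lambda>j. Z $$ (j, k)" "x $ \<sigma> k"]
    show "\<bar>x $ \<sigma> k\<bar> \<le> (\<Sum>j<n. \<bar>Z $$ (j, k)\<bar>)"
      by (rule recovery(1)) (use range[OF k] unit incoherent eq in auto)
    assume "(\<Sum>j<n. \<bar>Z $$ (j, k)\<bar>) \<le> \<bar>x $ \<sigma> k\<bar>" "j < n"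
    then have "Z $$ (j, k) = (if j = \<sigma> k then x $ \<sigma> k else 0)"
      by (intro recovery(2)) (use range[OF k] unit incoherent eq in auto)
    then show "Z $$ (j, k) = X\<^sub>0 $$ (j, k)" using \<open>j < n\<close> k by (auto simp: entry)
  qed
  have lower: "row_norm 1 X\<^sub>0 \<le> row_norm 1 Z"
    if "Z \<in> carrier_mat n r" "A * Z = A * X\<^sub>0" for Z
    unfolding norm_X0 row_norm_1_eq[OF that(1)] by (rule sum_mono) (use column(1) that in auto)
  have unique: "Z = X\<^sub>0"
    if Z: "Z \<in> carrier_mat n r" "A * Z = A * X\<^sub>0" and le: "row_norm 1 Z \<le> row_norm 1 X\<^sub>0" for Z
  proof -
    \<comment> \<open>Every column is bounded below by its own optimum, so one strict excess would
      make the total too large; hence all columns are tight.\<close>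
    have "(\<Sum>j<n. \<bar>Z $$ (j, k)\<bar>) \<le> \<bar>x $ \<sigma> k\<bar>" if "k < r" for k
    proof (rule ccontr)
      assume "\<not> ?thesis"
      then have "(\<Sum>k<r. \<bar>x $ \<sigma> k\<bar>) < (\<Sum>k<r. \<Sum>j<n. \<bar>Z $$ (j, k)\<bar>)"
        using column(1)[OF Z] \<open>k < r\<close> by (intro sum_strict_mono_ex1) (auto intro!: bexI[of _ k])
      with le show False unfolding norm_X0 row_norm_1_eq[OF Z(1)] by simp
    qed
    then have "Z $$ (j, k) = X\<^sub>0 $$ (j, k)" if "j < n" "k < r" for j k
      using column(2)[OF Z] that by blast
    moreover have "dim_row Z = n" "dim_col Z = r" "dim_row X\<^sub>0 = n" "dim_col X\<^sub>0 = r"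
      using Z X0 by auto
    ultimately show ?thesis by (simp add: mat_eq_iff)
  qed
  have "row_norm_solution 1 A (A * X\<^sub>0) r X \<longleftrightarrow>
      X \<in> carrier_mat n r \<and> A * X = A * X\<^sub>0 \<and>
      (\<forall>Z. Z \<in> carrier_mat n r \<and> A * Z = A * X\<^sub>0 \<longrightarrow> row_norm 1 X \<le> row_norm 1 Z)"
    using A by (auto simp: row_norm_solution_def is_arg_min_def not_less)
  with lower unique X0 show ?thesis by blast
qed

lemma l12_not_solution:
  assumes A: "A \<in> carrier_mat m n"
    and many: "m < card {i. i < n \<and> x $ i \<noteq> 0}"
  shows "\<not> row_norm_solution 2 A (A * X\<^sub>0) r X\<^sub>0"
proof -
  define S where "S = {i. i < n \<and> x $ i \<noteq> 0}"
  have S: "finite S" "S \<subseteq> {..<n}" by (auto simp: S_def)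
  obtain u where u: "\<exists>j\<in>S. u j \<noteq> 0" "\<forall>i<m. (\<Sum>j\<in>S. A $$ (i, j) * u j) = 0"
    using homogeneous_system_nontrivial_solution[OF S(1), of m "\<lambda>i j. A $$ (i, j)"] many
    by (auto simp: S_def)
  \<comment> \<open>Extension by zero puts \<open>v\<close> in the kernel of \<open>A\<close> and
    leaves the rows outside the support of \<open>x\<close> unmoved.\<close>
  define v where "v j = (if j \<in> S then u j else 0)" for j
  have v_kernel: "(\<Sum>j<n. A $$ (i, j) * v j) = 0" if "i < m" for i
  proof -
    have "(\<Sum>j<n. A $$ (i, j) * v j) = (\<Sum>j\<in>S. A $$ (i, j) * u j)"
      by (rule sum.mono_neutral_cong_right) (use S in \<open>auto simp: v_def\<close>)
    then show ?thesis using u(2) that by simp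
  qed
  \<comment> \<open>\<open>D\<close> is the first-order rate of decrease of the norm along the
    direction, and \<open>C\<close> below bounds the second-order growth. Where
    \<open>x $ j = 0\<close>, the summand of \<open>C\<close> vanishes since
    \<open>v j = 0\<close>.\<close>
  define D where "D = (\<Sum>j<n. (v j)\<^sup>2)"
  have "D > 0"
    unfolding D_def using u(1) S(2) by (force intro: sum_pos2 simp: v_def)
  \<comment> \<open>The sign makes the cross term of row \<open>\<sigma> k\<close> equal to
    \<open>- \<bar>x $ \<sigma> k\<bar> * (v (\<sigma> k))\<^sup>2\<close>, up to the factor
    \<open>2 * t\<close>.\<close>
  define w where "w k = - sgn (x $ \<sigma> k) * v (\<sigma> k)" for k
  define W where "W = (\<Sum>k<r. (w k)\<^sup>2)"
  define C where "C = (\<Sum>j<n. (v j)\<^sup>2 * W / (2 * \<bar>x $ j\<bar>))"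
  have "W \<ge> 0" by (auto simp: W_def intro: sum_nonneg)
  then have "C \<ge> 0" by (auto simp: C_def intro!: sum_nonneg)
  \<comment> \<open>small enough for the quadratic term \<open>t\<^sup>2 * C\<close> to be below the linear gain \<open>t * D\<close>\<close>
  define t where "t = D / (C + 1)"
  have "t > 0" using \<open>D > 0\<close> \<open>C \<ge> 0\<close> by (simp add: t_def)
  have "t * C < D"
    using \<open>D > 0\<close> \<open>C \<ge> 0\<close> by (simp add: t_def field_simps)
  define Z where "Z = mat n r (\<lambda>(j, k). X\<^sub>0 $$ (j, k) + t * v j * w k)"
  have Z: "Z \<in> carrier_mat n r" by (simp add: Z_def)
  have Z_entry: "Z $$ (j, k) = X\<^sub>0 $$ (j, k) + t * v j * w k" if "j < n" "k < r" for j k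
    using that by (simp add: Z_def)
  have feasible: "A * Z = A * X\<^sub>0"
    unfolding mat_mult_eq_iff[OF A Z X0]
  proof (intro allI impI)
    fix i k assume "i < m" "k < r"
    have "(\<Sum>j<n. A $$ (i, j) * Z $$ (j, k))
        = (\<Sum>j<n. A $$ (i, j) * X\<^sub>0 $$ (j, k) + A $$ (i, j) * v j * (t * w k))"
      using \<open>k < r\<close> by (intro sum.cong) (auto simp: Z_entry algebra_simps)
    also have "\<dots> = (\<Sum>j<n. A $$ (i, j) * X\<^sub>0 $$ (j, k)) + (\<Sum>j<n. A $$ (i, j) * v j) * (t * w k)"
      by (simp only: sum.distrib sum_distrib_right)
    finally show "(\<Sum>j<n. A $$ (i, j) * Z $$ (j, k)) = (\<Sum>j<n. A $$ (i, j) * X\<^sub>0 $$ (j, k))"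
      using v_kernel[OF \<open>i < m\<close>] by simp
  qed
  have row_le: "sqrt (\<Sum>k<r. (Z $$ (j, k))\<^sup>2) \<le>
      sqrt (\<Sum>k<r. (X\<^sub>0 $$ (j, k))\<^sup>2) - t * (v j)\<^sup>2 + t\<^sup>2 * ((v j)\<^sup>2 * W / (2 * \<bar>x $ j\<bar>))"
    if j: "j < n" for j
  proof (cases "j \<in> S")
    case False
    then show ?thesis using j by (simp add: Z_entry v_def)
  next
    case True
    then have xj: "x $ j \<noteq> 0" by (simp add: S_def)
    \<comment> \<open>By injectivity of \<open>\<sigma>\<close>, column \<open>l\<close> holds the
      only nonzero entry of row \<open>j\<close> of \<open>X\<^sub>0\<close>, so the cross term of
      the squared row norm comes from \<open>l\<close> alone.\<close>
    from support[OF j xj] obtain l where l: "l < r" "j = \<sigma> l" by auto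
    have l_iff: "j = \<sigma> k \<longleftrightarrow> k = l" if "k < r" for k
      using inj l that by (auto dest: inj_onD)
    have "(\<Sum>k<r. (X\<^sub>0 $$ (j, k))\<^sup>2) = (\<Sum>k<r. if k = l then (x $ j)\<^sup>2 else 0)"
      using j l_iff by (intro sum.cong) (auto simp: entry)
    then have row_X0: "sqrt (\<Sum>k<r. (X\<^sub>0 $$ (j, k))\<^sup>2) = \<bar>x $ j\<bar>"
      using l(1) by simp
    \<comment> \<open>The increment of the squared norm of row \<open>j\<close>, to be fed into the
      tangent bound.\<close>
    define s where "s = - 2 * t * \<bar>x $ j\<bar> * (v j)\<^sup>2 + t\<^sup>2 * (v j)\<^sup>2 * W"
    have "(\<Sum>k<r. (Z $$ (j, k))\<^sup>2)
        = (\<Sum>k<r. (if k = l then (x $ j)\<^sup>2 + 2 * t * v j * (x $ j * w l) else 0)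
            + t\<^sup>2 * (v j)\<^sup>2 * (w k)\<^sup>2)"
      using j l_iff
      by (intro sum.cong) (auto simp: Z_entry entry power2_eq_square algebra_simps)
    also have "\<dots> = (x $ j)\<^sup>2 + 2 * t * v j * (x $ j * w l) + t\<^sup>2 * (v j)\<^sup>2 * W"
      using l(1) by (simp add: sum.distrib W_def sum_distrib_left)
    also have "x $ j * w l = - \<bar>x $ j\<bar> * v j"
      by (simp add: w_def l(2)[symmetric] abs_sgn)
    also have "(x $ j)\<^sup>2 + 2 * t * v j * (- \<bar>x $ j\<bar> * v j) + t\<^sup>2 * (v j)\<^sup>2 * W = (x $ j)\<^sup>2 + s"
      by (simp add: s_def power2_eq_square)
    finally have row_Z: "(\<Sum>k<r. (Z $$ (j, k))\<^sup>2) = (x $ j)\<^sup>2 + s" .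
    have "0 \<le> (\<Sum>k<r. (Z $$ (j, k))\<^sup>2)" by (rule sum_nonneg) simp
    then have "sqrt ((x $ j)\<^sup>2 + s) \<le> \<bar>x $ j\<bar> + s / (2 * \<bar>x $ j\<bar>)"
      using row_Z by (intro sqrt_square_add_le[OF xj]) simp
    also have "\<dots> = \<bar>x $ j\<bar> - t * (v j)\<^sup>2 + t\<^sup>2 * ((v j)\<^sup>2 * W / (2 * \<bar>x $ j\<bar>))"
      using xj by (simp add: s_def field_simps)
    finally show ?thesis unfolding row_Z row_X0 .
  qed
  have "row_norm 2 Z \<le> (\<Sum>j<n. sqrt (\<Sum>k<r. (X\<^sub>0 $$ (j, k))\<^sup>2) - t * (v j)\<^sup>2
      + t\<^sup>2 * ((v j)\<^sup>2 * W / (2 * \<bar>x $ j\<bar>)))"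
    unfolding row_norm_2_eq[OF Z] by (intro sum_mono row_le) simp
  also have "\<dots> = row_norm 2 X\<^sub>0 - t * D + t\<^sup>2 * C"
    unfolding row_norm_2_eq[OF X0] D_def C_def
    by (simp only: sum.distrib sum_subtractf sum_distrib_left)
  also have "\<dots> < row_norm 2 X\<^sub>0"
    using mult_strict_left_mono[OF \<open>t * C < D\<close> \<open>t > 0\<close>] by (simp add: power2_eq_square mult.assoc)
  finally show ?thesis
    using Z feasible A by (auto simp: row_norm_solution_def is_arg_min_def)
qed

end

section \<open>Both forms of the diagonal matrix, and the theorem\<close>

lemma diagonal_columns_mat_diag:
  "diagonal_columns n n x id (mat_diag n (\<lambda>i. x $ i))"
  by unfold_locales (auto simp: mat_diag_def)

lemma diagonal_columns_remove_zero_cols: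
  fixes x :: "real vec"
  shows "\<exists>r \<sigma>. diagonal_columns n r x \<sigma> (remove_zero_cols (mat_diag n (\<lambda>i. x $ i)))"
proof -
  let ?X = "mat_diag n (\<lambda>i. x $ i)"
  \<comment> \<open>The increasing list of the support of \<open>x\<close>; its indexing function is
    the required \<open>\<sigma>\<close>.\<close>
  define js where "js = filter (\<lambda>j. col ?X j \<noteq> 0\<^sub>v n) [0..<n]"
  have js: "set js = {j. j < n \<and> x $ j \<noteq> 0}"
    by (auto simp: js_def mat_diag_def vec_eq_iff split: if_splits)
  have distinct: "distinct js" by (simp add: js_def)
  have js_lt: "js ! k < n" if "k < length js" for k
    using nth_mem[OF that] js by auto
  have "filter (\<lambda>c. c \<noteq> 0\<^sub>v n) (cols ?X) = map (col ?X) js"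
    by (simp add: cols_def js_def filter_map o_def mat_diag_def)
  then have eq: "remove_zero_cols ?X = mat_of_cols n (map (col ?X) js)"
    by (simp add: remove_zero_cols_def mat_diag_def)
  have "diagonal_columns n (length js) x ((!) js) (remove_zero_cols ?X)"
    unfolding eq
  proof unfold_locales
    show "inj_on ((!) js) {..<length js}"
      using distinct by (auto simp: inj_on_def nth_eq_iff_index_eq)
    show "j \<in> (!) js ` {..<length js}" if "j < n" "x $ j \<noteq> 0" for j
    proof -
      have "j \<in> set js" using js that by simp
      then show ?thesis by (auto simp: in_set_conv_nth)
    qed
    show "mat_of_cols n (map (col ?X) js) $$ (j, k) = (if j = js ! k then x $ j else 0)"
      if "j < n" "k < length js" for j k
      using that js_lt by (auto simp: mat_of_cols_index mat_diag_def)
  qed (auto simp: js_lt)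
  then show ?thesis by blast
qed

theorem mainTheorem4:
  fixes m n :: nat and A X\<^sub>0 B :: "real mat" and x :: "real vec"
  assumes "A \<in> carrier_mat m n"
    and "m < n"
    and "\<forall>j<n. vec_lnorm 2 (col A j) = 1"
    and "\<forall>i<n. \<forall>j<n. i \<noteq> j \<longrightarrow> \<not> (\<exists>c. col A i = c \<cdot>\<^sub>v col A j)"
    and "x \<in> carrier_vec n"
    and "card {i. i < n \<and> x $ i \<noteq> 0} \<ge> m + 1"
    and "X\<^sub>0 = mat_diag n (\<lambda>i. x $ i) \<or>
         X\<^sub>0 = remove_zero_cols (mat_diag n (\<lambda>i. x $ i))"
    and "B = A * X\<^sub>0"
  shows "(\<forall>X. row_norm_solution 1 A B (dim_col X\<^sub>0) X \<longleftrightarrow> X = X\<^sub>0) \<and>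
         \<not> row_norm_solution 2 A B (dim_col X\<^sub>0) X\<^sub>0"
proof -
  note A = assms(1)
  have unit: "(\<Sum>i<m. (A $$ (i, j))\<^sup>2) = 1" if "j < n" for j
    using assms(3) that A by (auto simp: vec_lnorm_def simp flip: sqrt_def)
  have incoherent: "\<bar>\<Sum>l<m. A $$ (l, i) * A $$ (l, j)\<bar> < 1"
    if "i < n" "j < n" "i \<noteq> j" for i j
  proof (rule abs_inner_unit_less_one)
    show "\<not> (\<exists>c. \<forall>l\<in>{..<m}. A $$ (l, i) = c * A $$ (l, j))"
    proof
      assume "\<exists>c. \<forall>l\<in>{..<m}. A $$ (l, i) = c * A $$ (l, j)"
      then obtain c where "\<forall>l\<in>{..<m}. A $$ (l, i) = c * A $$ (l, j)" by blast
      then have "col A i = c \<cdot>\<^sub>v col A j"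
        using A that by (intro eq_vecI) auto
      with assms(4) that show False by blast
    qed
  qed (use unit that in auto)
  \<comment> \<open>From here on the two readings of \<open>X\<^sub>0\<close>, with and without its
    zero columns, need no separate treatment.\<close>
  obtain r \<sigma> where "diagonal_columns n r x \<sigma> X\<^sub>0"
    using assms(7) diagonal_columns_mat_diag diagonal_columns_remove_zero_cols by metis
  then interpret diagonal_columns n r x \<sigma> X\<^sub>0 .
  have "dim_col X\<^sub>0 = r" using X0 by simp
  then show ?thesis
    using l11_unique_solution[OF A unit incoherent] l12_not_solution[OF A] assms(6,8) by simp
qed

end
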